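(* Let $G$ be an arbitrary graph. Then $\chi_{i}(G)=\Delta(G)$ if and only if $G\in \Theta$.
   Context: All graphs are finite and simple. An injective $k$-coloring function of a graph $G$ is a function $f:V(G)\to\{1,\dots,k\}$ such that no vertex $v$ is adjacent to two distinct vertices $u$ and $w$ with $f(u)=f(w)$ (adjacent vertices may receive the same color). The injective chromatic number $\chi_i(G)$ is the minimum $k$ for which $G$ admits an injective $k$-coloring function. $\Delta(G)$ denotes the maximum degree of $G$. For disjoint $A,B\subseteq V(G)$, $[A,B]$ denotes the set of all edges of $G$ with one end-vertex in $A$ and the other in $B$. A matching is a (possibly empty) set of pairwise non-incident edges. The family $\Theta$ consists of all graphs $G$ obtained as follows. Begin with any graphs $H_1,\dots,H_t$ ($t\ge 1$, each with at least one vertex) of maximum degree at most $1$, such that at least one of them, say $H_k$, contains at least one edge. Let $v$ be a non-isolated vertex of $H_k$. Let $G$ be obtained from the disjoint union $H_1+\cdots+H_t$ by (a) joining $v$ by an edge to precisely one vertex of $H_i$ for each $1\le i\le t$ with $i\neq k$, and (b) adding some edges (possibly none) with one end-vertex in $V(H_i)$ and the other one in $V(H_j)$, $i\ne j$, such that in the resulting graph $G$ the set $[V(H_i),V(H_j)]$ is a matching for each $1\leq i\neq j\leq t$ (the empty set is allowed as a matching). *)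

theory Defs
  imports Main "HOL-Library.Disjoint_Sets"
begin

record 'a graph =
  verts :: "'a set"
  edges :: "'a set set"

definition simple_graph :: "'a graph \<Rightarrow> bool" where
  "simple_graph G \<longleftrightarrow> finite (verts G) \<and>
     (\<forall>e\<in>edges G. \<exists>x\<in>verts G. \<exists>y\<in>verts G. x \<noteq> y \<and> e = {x, y})"

definition degree :: "'a graph \<Rightarrow> 'a \<Rightarrow> nat" where
  "degree G v = card {e \<in> edges G. v \<in> e}"

text \<open>Only meaningful for finite graphs with at least one vertex
  (\<^const>\<open>Max\<close> of the empty set is unspecified).\<close>
definition max_degree :: "'a graph \<Rightarrow> nat" where
  "max_degree G = Max (degree G ` verts G)"

definition injective_coloring :: "'a graph \<Rightarrow> nat \<Rightarrow> ('a \<Rightarrow> nat) \<Rightarrow> bool" where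
  "injective_coloring G k f \<longleftrightarrow> f ` verts G \<subseteq> {1..k} \<and>
     (\<forall>v\<in>verts G. \<not> (\<exists>u\<in>verts G. \<exists>w\<in>verts G.
        u \<noteq> w \<and> {v, u} \<in> edges G \<and> {v, w} \<in> edges G \<and> f u = f w))"

definition injective_chromatic_number :: "'a graph \<Rightarrow> nat" where
  "injective_chromatic_number G = (LEAST k. \<exists>f. injective_coloring G k f)"

definition edges_between :: "'a graph \<Rightarrow> 'a set \<Rightarrow> 'a set \<Rightarrow> 'a set set" where
  "edges_between G A B = {e \<in> edges G. \<exists>a\<in>A. \<exists>b\<in>B. e = {a, b}}"

definition matching :: "'a set set \<Rightarrow> bool" where
  "matching M \<longleftrightarrow> pairwise disjnt M"

text \<open>The disjoint union \<open>H 1 + \<dots> + H t\<close> is the plain union of graphs with pairwise disjoint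
  vertex sets. For \<open>i \<noteq> k\<close>, \<open>w i\<close> is the vertex of \<open>H i\<close> that \<open>v\<close> is joined to in step (a),
  and \<open>B\<close> is the set of edges added in step (b).\<close>
definition Theta :: "'a graph set" where
  "Theta = {G. \<exists>(t::nat) (H :: nat \<Rightarrow> 'a graph) k v w B.
     t \<ge> 1 \<and>
     (\<forall>i\<in>{1..t}. simple_graph (H i) \<and> verts (H i) \<noteq> {} \<and> max_degree (H i) \<le> 1) \<and>
     disjoint_family_on (\<lambda>i. verts (H i)) {1..t} \<and>
     k \<in> {1..t} \<and> edges (H k) \<noteq> {} \<and>
     v \<in> verts (H k) \<and> degree (H k) v \<noteq> 0 \<and>
     (\<forall>i\<in>{1..t} - {k}. w i \<in> verts (H i)) \<and>
     (\<forall>e\<in>B. \<exists>i\<in>{1..t}. \<exists>j\<in>{1..t}. i \<noteq> j \<and>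
        (\<exists>x\<in>verts (H i). \<exists>y\<in>verts (H j). e = {x, y})) \<and>
     G = \<lparr>verts = (\<Union>i\<in>{1..t}. verts (H i)),
          edges = (\<Union>i\<in>{1..t}. edges (H i)) \<union> (\<lambda>i. {v, w i}) ` ({1..t} - {k}) \<union> B\<rparr> \<and>
     (\<forall>i\<in>{1..t}. \<forall>j\<in>{1..t}. i \<noteq> j \<longrightarrow>
        matching (edges_between G (verts (H i)) (verts (H j))))}"

end

theory Submission
  imports Defs
begin

text \<open>A coloring is injective iff it is injective on every neighborhood, so \<open>k \<ge> \<Delta>(G)\<close> for
  every injective \<open>k\<close>-coloring. If \<open>k = \<Delta>(G)\<close>, a vertex of maximum degree sees every color exactly
  once, its own included; the color classes are then the graphs \<open>H i\<close>. Conversely, coloring each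
  \<open>H i\<close> with \<open>i\<close> is injective, and the vertex \<open>v\<close> has a neighbor in each \<open>H i\<close>, whence
  \<open>\<chi>\<^sub>i(G) \<le> t \<le> \<Delta>(G)\<close>.\<close>

section \<open>Neighborhoods and degrees in simple graphs\<close>

definition neighborhood :: "'a graph \<Rightarrow> 'a \<Rightarrow> 'a set" where
  "neighborhood G v = {u. {v, u} \<in> edges G}"

lemma simple_graph_edgeD:
  assumes "simple_graph G" "{v, u} \<in> edges G"
  shows "v \<in> verts G" "u \<in> verts G" "v \<noteq> u"
  using assms unfolding simple_graph_def by (force simp: doubleton_eq_iff)+

lemma simple_graph_edgeE:
  assumes "simple_graph G" "e \<in> edges G"
  obtains x y where "x \<in> verts G" "y \<in> verts G" "x \<noteq> y" "e = {x, y}"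
  using assms unfolding simple_graph_def by metis

lemma neighborhood_subset_verts:
  "simple_graph G \<Longrightarrow> neighborhood G v \<subseteq> verts G"
  by (auto simp: neighborhood_def dest: simple_graph_edgeD)

lemma finite_neighborhood:
  "simple_graph G \<Longrightarrow> finite (neighborhood G v)"
  by (meson neighborhood_subset_verts finite_subset simple_graph_def)

text \<open>The map sending \<open>u\<close> to \<open>{v, u}\<close> is a bijection from the
  neighbors of \<open>v\<close> onto the edges at \<open>v\<close>. Degrees can then be compared
  with sets of colors.\<close>

lemma degree_eq_card_neighborhood:
  assumes "simple_graph G"
  shows "degree G v = card (neighborhood G v)"
proof -
  have "e \<in> (\<lambda>u. {v, u}) ` neighborhood G v" if edge: "e \<in> edges G" "v \<in> e" for e
  proof -
    obtain x y where e: "e = {x, y}"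
      by (rule simple_graph_edgeE[OF assms edge(1)])
    have "v = x \<or> v = y"
      using e edge(2) by simp
    then obtain u where "e = {v, u}"
      using e by (metis insert_commute)
    then show ?thesis
      using edge(1) by (intro image_eqI[of _ _ u]) (simp_all add: neighborhood_def)
  qed
  then have "{e \<in> edges G. v \<in> e} = (\<lambda>u. {v, u}) ` neighborhood G v"
    by (auto simp: neighborhood_def)
  moreover have "inj_on (\<lambda>u. {v, u}) (neighborhood G v)"
    by (auto simp: inj_on_def doubleton_eq_iff)
  ultimately show ?thesis
    by (simp add: degree_def card_image)
qed

lemma degree_le_max_degree:
  "simple_graph G \<Longrightarrow> v \<in> verts G \<Longrightarrow> degree G v \<le> max_degree G"
  by (simp add: max_degree_def simple_graph_def)

lemma max_degree_attained:
  assumes "simple_graph G" "verts G \<noteq> {}"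
  obtains v where "v \<in> verts G" "degree G v = max_degree G"
proof -
  have "max_degree G \<in> degree G ` verts G"
    using assms unfolding max_degree_def simple_graph_def by (intro Max_in) auto
  then obtain v where "v \<in> verts G" "max_degree G = degree G v"
    by (rule imageE)
  then show ?thesis
    by (intro that[of v]) simp_all
qed

section \<open>Injective colorings and the injective chromatic number\<close>

lemma injective_coloring_iff_inj_on_neighborhood:
  assumes "simple_graph G"
  shows "injective_coloring G k f \<longleftrightarrow>
    f ` verts G \<subseteq> {1..k} \<and> (\<forall>v\<in>verts G. inj_on f (neighborhood G v))"
proof (intro iffI conjI ballI inj_onI; (elim conjE)?)
  fix v a b
  assume col: "injective_coloring G k f" and v: "v \<in> verts G" "a \<in> neighborhood G v"
    "b \<in> neighborhood G v" "f a = f b"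
  then have "a \<in> verts G" "b \<in> verts G"
    using neighborhood_subset_verts[OF assms] by blast+
  with col v show "a = b"
    unfolding injective_coloring_def neighborhood_def mem_Collect_eq by blast
next
  assume "f ` verts G \<subseteq> {1..k}" "\<forall>v\<in>verts G. inj_on f (neighborhood G v)"
  then show "injective_coloring G k f"
    unfolding injective_coloring_def neighborhood_def inj_on_def mem_Collect_eq by blast
qed (simp add: injective_coloring_def)

text \<open>\<open>f\<close> maps the neighborhood of \<open>v\<close> injectively into the
  \<open>k\<close> colors.\<close>

lemma degree_le_colors:
  assumes "simple_graph G" "injective_coloring G k f" "v \<in> verts G"
  shows "degree G v \<le> k"
proof -
  have "inj_on f (neighborhood G v)" "f ` neighborhood G v \<subseteq> {1..k}"
    using assms neighborhood_subset_verts[OF assms(1)]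
    unfolding injective_coloring_iff_inj_on_neighborhood[OF assms(1)] by blast+
  then have "card (neighborhood G v) \<le> card {1..k}"
    by (intro card_inj_on_le) auto
  then show ?thesis
    by (simp add: degree_eq_card_neighborhood assms(1))
qed

lemma max_degree_le_colors:
  assumes "simple_graph G" "verts G \<noteq> {}" "injective_coloring G k f"
  shows "max_degree G \<le> k"
proof -
  obtain v where "v \<in> verts G" "degree G v = max_degree G"
    by (rule max_degree_attained[OF assms(1,2)])
  then show ?thesis
    using degree_le_colors[OF assms(1,3), of v] by simp
qed

lemma injective_chromatic_number_le:
  "injective_coloring G k f \<Longrightarrow> injective_chromatic_number G \<le> k"
  unfolding injective_chromatic_number_def by (rule Least_le, rule exI)

text \<open>Giving all vertices different colors is always an injective coloring, so the
  \<open>LEAST\<close> in the definition ranges over a nonempty set and is attained.\<close>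

lemma injective_chromatic_number_attained:
  assumes "simple_graph G"
  obtains f where "injective_coloring G (injective_chromatic_number G) f"
proof -
  have "finite (verts G)"
    using assms by (simp add: simple_graph_def)
  then obtain f :: "'a \<Rightarrow> nat" where "bij_betw f (verts G) {1..card (verts G)}"
    using finite_same_card_bij[of "verts G" "{1..card (verts G)}"] by auto
  then have "f ` verts G \<subseteq> {1..card (verts G)}" "inj_on f (verts G)"
    by (auto simp: bij_betw_def)
  then have "injective_coloring G (card (verts G)) f"
    unfolding injective_coloring_iff_inj_on_neighborhood[OF assms]
    using neighborhood_subset_verts[OF assms] by (meson inj_on_subset)
  then have "\<exists>k f. injective_coloring G k f"
    by blast
  then have "\<exists>f. injective_coloring G (injective_chromatic_number G) f"
    unfolding injective_chromatic_number_def by (rule LeastI_ex)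
  then show ?thesis by (elim exE) (rule that)
qed

section \<open>From the family \<open>Theta\<close> to a coloring\<close>

text \<open>Suppose two neighbors of \<open>x\<close> share a color, that is, lie in the same
  \<open>H i\<close>. If \<open>x\<close> lies there too, they coincide because \<open>H i\<close>
  has maximum degree at most 1; otherwise they coincide because the edges between two parts form a
  matching.\<close>

lemma Theta_imp_chromatic_number_le_max_degree:
  assumes simple: "simple_graph G" and "G \<in> Theta"
  shows "injective_chromatic_number G \<le> max_degree G"
proof -
  obtain t :: nat and H k v w B where
    H: "\<forall>i\<in>{1..t}. simple_graph (H i) \<and> verts (H i) \<noteq> {} \<and> max_degree (H i) \<le> 1"
    and disj: "disjoint_family_on (\<lambda>i. verts (H i)) {1..t}"
    and k: "k \<in> {1..t}" and v: "v \<in> verts (H k)" "degree (H k) v \<noteq> 0"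
    and w: "\<forall>i\<in>{1..t} - {k}. w i \<in> verts (H i)"
    and B: "\<forall>e\<in>B. \<exists>i\<in>{1..t}. \<exists>j\<in>{1..t}. i \<noteq> j \<and>
        (\<exists>x\<in>verts (H i). \<exists>y\<in>verts (H j). e = {x, y})"
    and G: "G = \<lparr>verts = (\<Union>i\<in>{1..t}. verts (H i)),
          edges = (\<Union>i\<in>{1..t}. edges (H i)) \<union> (\<lambda>i. {v, w i}) ` ({1..t} - {k}) \<union> B\<rparr>"
    and match: "\<forall>i\<in>{1..t}. \<forall>j\<in>{1..t}. i \<noteq> j \<longrightarrow>
        matching (edges_between G (verts (H i)) (verts (H j)))"
    using \<open>G \<in> Theta\<close> unfolding Theta_def mem_Collect_eq
    by (elim exE conjE) (rule that)
  have simpleH: "simple_graph (H i)" and maxH: "max_degree (H i) \<le> 1" if "i \<in> {1..t}" for i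
    using H that by blast+
  have vertsG: "verts G = (\<Union>i\<in>{1..t}. verts (H i))"
    and edgesG: "edges G = (\<Union>i\<in>{1..t}. edges (H i)) \<union> (\<lambda>i. {v, w i}) ` ({1..t} - {k}) \<union> B"
    by (subst G; simp)+
  have unique: "i = j" if "x \<in> verts (H i)" "x \<in> verts (H j)" "i \<in> {1..t}" "j \<in> {1..t}" for x i j
    using disj that unfolding disjoint_family_on_def by blast
  \<comment> \<open>The index of the part containing \<open>x\<close>. It is unique by disjointness
    of the parts; only values on \<open>verts G\<close> matter.\<close>
  define f where "f x = (THE i. i \<in> {1..t} \<and> x \<in> verts (H i))" for x
  have f_eq: "f x = i" if "i \<in> {1..t}" "x \<in> verts (H i)" for x i
    unfolding f_def using that unique by (intro the_equality) auto
  have f: "f x \<in> {1..t}" "x \<in> verts (H (f x))" if x: "x \<in> verts G" for x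
  proof -
    obtain i where "i \<in> {1..t}" "x \<in> verts (H i)"
      using x unfolding vertsG by blast
    then show "f x \<in> {1..t}" "x \<in> verts (H (f x))"
      by (simp_all only: f_eq)
  qed
  \<comment> \<open>The edges added in (a) and (b) all run between different parts, so an edge with
    equally colored ends must come from some \<open>H i\<close>.\<close>
  have cross: "f x \<noteq> f y" if xy: "{x, y} \<in> B \<union> (\<lambda>i. {v, w i}) ` ({1..t} - {k})" for x y
  proof -
    have "\<exists>i\<in>{1..t}. \<exists>j\<in>{1..t}. i \<noteq> j \<and>
        (\<exists>a\<in>verts (H i). \<exists>b\<in>verts (H j). {x, y} = {a, b})"
      using xy
    proof
      assume "{x, y} \<in> (\<lambda>i. {v, w i}) ` ({1..t} - {k})"
      then obtain i where "i \<in> {1..t} - {k}" "{x, y} = {v, w i}" by (rule imageE) simp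
      then show ?thesis
        using k v(1) w by (intro bexI[of _ k] bexI[of _ i] conjI bexI[of _ v] bexI[of _ "w i"]) simp_all
    qed (rule bspec[OF B])
    then obtain i j a b where "i \<in> {1..t}" "j \<in> {1..t}" "i \<noteq> j"
      "a \<in> verts (H i)" "b \<in> verts (H j)" "{x, y} = {a, b}"
      by (elim bexE conjE)
    moreover from this have "f a = i" "f b = j"
      by (simp_all only: f_eq)
    ultimately show ?thesis
      unfolding doubleton_eq_iff by metis
  qed
  have same: "{x, y} \<in> edges (H (f x))" if xy: "{x, y} \<in> edges G" "f x = f y" for x y
  proof -
    obtain i where i: "i \<in> {1..t}" "{x, y} \<in> edges (H i)"
      using xy cross[of x y] unfolding edgesG by blast
    then have "f x = i"
      using simple_graph_edgeD(1)[OF simpleH] f_eq by blast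
    with i show ?thesis by simp
  qed
  have "a = b" if ab: "{x, a} \<in> edges G" "{x, b} \<in> edges G" "f a = f b" for x a b
  proof (cases "f x = f a")
    case True
    have x: "x \<in> verts G"
      using simple_graph_edgeD[OF simple] ab by blast
    have "a \<in> neighborhood (H (f x)) x" "b \<in> neighborhood (H (f x)) x"
      using same[of x a] same[of x b] ab True by (simp_all add: neighborhood_def)
    moreover have "card (neighborhood (H (f x)) x) \<le> Suc 0"
      using degree_le_max_degree[OF simpleH f(2)] maxH f(1) x
        degree_eq_card_neighborhood[OF simpleH] by (metis One_nat_def le_trans)
    ultimately show ?thesis
      using card_le_Suc0_iff_eq[OF finite_neighborhood[OF simpleH[OF f(1)[OF x]]]] by blast
  next
    case False
    have verts: "x \<in> verts G" "a \<in> verts G" "b \<in> verts G"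
      using simple_graph_edgeD[OF simple] ab by blast+
    have "{x, a} \<in> edges_between G (verts (H (f x))) (verts (H (f a)))"
      using ab(1) f(2)[OF verts(1)] f(2)[OF verts(2)] unfolding edges_between_def by blast
    moreover have "{x, b} \<in> edges_between G (verts (H (f x))) (verts (H (f a)))"
      using ab(2) f(2)[OF verts(1)] f(2)[OF verts(3)] ab(3) unfolding edges_between_def by auto
    moreover have "matching (edges_between G (verts (H (f x))) (verts (H (f a))))"
      using match f(1)[OF verts(1)] f(1)[OF verts(2)] False by blast
    \<comment> \<open>Both edges contain \<open>x\<close>, so they are not disjoint and can only lie
      in a common matching if they are equal.\<close>
    ultimately have "{x, a} = {x, b}"
      unfolding matching_def by (auto dest: pairwiseD simp: disjnt_def)
    then show ?thesis by (auto simp: doubleton_eq_iff)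
  qed
  then have "injective_coloring G t f"
    unfolding injective_coloring_iff_inj_on_neighborhood[OF simple]
    using f(1) by (auto simp: inj_on_def neighborhood_def simp del: atLeastAtMost_iff)
  then have "injective_chromatic_number G \<le> t"
    by (rule injective_chromatic_number_le)
  also have "t \<le> degree G v"
  proof -
    \<comment> \<open>Step (a) gives \<open>v\<close> no neighbor in its own part
      \<open>H k\<close>; the color \<open>k\<close> is supplied by a neighbor inside
      \<open>H k\<close>, which exists since \<open>v\<close> is not isolated there.\<close>
    obtain u where u: "{v, u} \<in> edges (H k)"
      using v(2) degree_eq_card_neighborhood[OF simpleH[OF k]]
      unfolding neighborhood_def by fastforce
    then have "u \<in> verts (H k)"
      using simple_graph_edgeD[OF simpleH[OF k]] by blast
    have "{1..t} \<subseteq> f ` neighborhood G v"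
    proof
      fix i assume i: "i \<in> {1..t}"
      show "i \<in> f ` neighborhood G v"
      proof (cases "i = k")
        case True
        with i u \<open>u \<in> verts (H k)\<close> show ?thesis
          by (intro image_eqI[of _ _ u]) (auto simp: f_eq neighborhood_def edgesG)
      next
        case False
        with i w show ?thesis
          by (intro image_eqI[of _ _ "w i"]) (auto simp: f_eq neighborhood_def edgesG)
      qed
    qed
    then have "card {1..t} \<le> card (neighborhood G v)"
      using finite_neighborhood[OF simple] by (rule surj_card_le[rotated])
    then show ?thesis
      by (simp add: degree_eq_card_neighborhood[OF simple])
  qed
  also have "\<dots> \<le> max_degree G"
    using degree_le_max_degree[OF simple] k v(1) vertsG by blast
  finally show ?thesis .
qed

section \<open>From a coloring to the family \<open>Theta\<close>\<close>

text \<open>The color classes serve as the \<open>H i\<close>, and a vertex \<open>v\<close> of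
  maximum degree serves as the distinguished vertex, in the class \<open>f v\<close>. Injectivity on
  neighborhoods yields both the degree bound inside a class and the matchings between
  classes.\<close>

lemma max_degree_coloring_imp_Theta:
  assumes simple: "simple_graph G" and nonempty: "verts G \<noteq> {}"
    and col: "injective_coloring G (max_degree G) f"
  shows "G \<in> Theta"
proof -
  define t where "t = max_degree G"
  have f: "f x \<in> {1..t}" if "x \<in> verts G" for x
    using col that unfolding injective_coloring_def t_def by blast
  have inj: "a = b" if "{x, a} \<in> edges G" "{x, b} \<in> edges G" "f a = f b" for x a b
  proof -
    have "x \<in> verts G" "a \<in> neighborhood G x" "b \<in> neighborhood G x"
      using that simple_graph_edgeD(1)[OF simple] by (simp_all add: neighborhood_def)
    then show ?thesis
      using col that(3) injective_coloring_iff_inj_on_neighborhood[OF simple]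
      by (metis inj_onD)
  qed
  obtain v where v: "v \<in> verts G" "degree G v = t"
    unfolding t_def by (rule max_degree_attained[OF simple nonempty])
  \<comment> \<open>\<open>f\<close> is injective on the \<open>t\<close> neighbors of
    \<open>v\<close> and there are only \<open>t\<close> colors, so every color occurs among
    them.\<close>
  have img: "f ` neighborhood G v = {1..t}"
  proof (rule card_subset_eq)
    show "f ` neighborhood G v \<subseteq> {1..t}"
      using f neighborhood_subset_verts[OF simple] by blast
    have "inj_on f (neighborhood G v)"
      using inj by (auto simp: inj_on_def neighborhood_def)
    then show "card (f ` neighborhood G v) = card {1..t}"
      using v(2) by (simp add: card_image degree_eq_card_neighborhood[OF simple])
  qed simp
  have "\<forall>i\<in>{1..t}. \<exists>u. {v, u} \<in> edges G \<and> f u = i"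
  proof
    fix i assume "i \<in> {1..t}"
    then have "i \<in> f ` neighborhood G v" by (simp only: img)
    then obtain u where "i = f u" "u \<in> neighborhood G v" by (rule imageE)
    then show "\<exists>u. {v, u} \<in> edges G \<and> f u = i"
      by (intro exI[of _ u]) (simp add: neighborhood_def)
  qed
  \<comment> \<open>\<open>w i\<close> is the neighbor of \<open>v\<close> of color
    \<open>i\<close>. For \<open>i = f v\<close> it gives an edge at \<open>v\<close> inside the
    class of \<open>v\<close>; the others give the edges of step (a).\<close>
  from bchoice[OF this]
  obtain w where "\<forall>i\<in>{1..t}. {v, w i} \<in> edges G \<and> f (w i) = i" ..
  then have w: "{v, w i} \<in> edges G \<and> f (w i) = i" if "i \<in> {1..t}" for i
    using that by (rule bspec)
  have w_verts: "w i \<in> verts G" if "i \<in> {1..t}" for i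
    using w[OF that] by (intro simple_graph_edgeD(2)[OF simple, of v]) simp
  define H where "H i = \<lparr>verts = {x \<in> verts G. f x = i},
      edges = {e \<in> edges G. \<forall>x\<in>e. f x = i}\<rparr>" for i
  \<comment> \<open>All edges with differently colored ends, including those from \<open>v\<close>
    to \<open>w i\<close>. The overlap with step (a) is harmless, as \<open>Theta\<close> takes the
    union of the edge sets.\<close>
  define B where "B = {e \<in> edges G. \<exists>x\<in>e. \<exists>y\<in>e. f x \<noteq> f y}"
  have simpleH: "simple_graph (H i)" for i
    unfolding simple_graph_def
  proof (intro conjI ballI)
    show "finite (verts (H i))"
      using simple by (simp add: simple_graph_def H_def)
    fix e assume e: "e \<in> edges (H i)"
    then have "e \<in> edges G" by (simp add: H_def)
    then obtain x y where "x \<in> verts G" "y \<in> verts G" "x \<noteq> y" "e = {x, y}"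
      by (rule simple_graph_edgeE[OF simple])
    with e show "\<exists>x\<in>verts (H i). \<exists>y\<in>verts (H i). x \<noteq> y \<and> e = {x, y}"
      by (intro bexI[of _ x] bexI[of _ y]) (simp_all add: H_def)
  qed
  have nonemptyH: "verts (H i) \<noteq> {}" if "i \<in> {1..t}" for i
    using w[OF that] w_verts[OF that] unfolding H_def by auto
  have maxH: "max_degree (H i) \<le> 1" if i: "i \<in> {1..t}" for i
  proof -
    obtain x where x: "x \<in> verts (H i)" "degree (H i) x = max_degree (H i)"
      by (rule max_degree_attained[OF simpleH nonemptyH[OF i]])
    \<comment> \<open>All neighbors of \<open>x\<close> within the class have color
      \<open>i\<close>, so injectivity around \<open>x\<close> leaves at most one.\<close>
    have "\<forall>a\<in>neighborhood (H i) x. \<forall>b\<in>neighborhood (H i) x. a = b"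
    proof (intro ballI)
      fix a b assume "a \<in> neighborhood (H i) x" "b \<in> neighborhood (H i) x"
      then show "a = b"
        by (intro inj[of x a b]) (simp_all add: neighborhood_def H_def)
    qed
    then have "card (neighborhood (H i) x) \<le> Suc 0"
      by (simp only: card_le_Suc0_iff_eq[OF finite_neighborhood[OF simpleH]])
    with x(2) show ?thesis
      by (simp add: degree_eq_card_neighborhood[OF simpleH])
  qed
  have disj: "disjoint_family_on (\<lambda>i. verts (H i)) {1..t}"
    by (auto simp: disjoint_family_on_def H_def)
  \<comment> \<open>This also forces \<open>t\<close> to be positive: an edgeless graph with a
    vertex has maximum degree 0 and no coloring with 0 colors.\<close>
  have k: "f v \<in> {1..t}"
    using f v(1) by blast
  have edge_v: "{v, w (f v)} \<in> edges (H (f v))"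
    using w[OF k] by (simp add: H_def)
  have v': "v \<in> verts (H (f v))" "degree (H (f v)) v \<noteq> 0"
  proof -
    show "v \<in> verts (H (f v))"
      using v(1) by (simp add: H_def)
    have "w (f v) \<in> neighborhood (H (f v)) v"
      using edge_v by (simp add: neighborhood_def)
    then show "degree (H (f v)) v \<noteq> 0"
      using finite_neighborhood[OF simpleH] degree_eq_card_neighborhood[OF simpleH]
      by (metis card_0_eq empty_iff)
  qed
  have wH: "\<forall>i\<in>{1..t} - {f v}. w i \<in> verts (H i)"
    using w w_verts by (simp add: H_def)
  have BH: "\<forall>e\<in>B. \<exists>i\<in>{1..t}. \<exists>j\<in>{1..t}. i \<noteq> j \<and>
      (\<exists>x\<in>verts (H i). \<exists>y\<in>verts (H j). e = {x, y})"
  proof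
    fix e assume e: "e \<in> B"
    then have "e \<in> edges G" by (simp add: B_def)
    then obtain x y where xy: "x \<in> verts G" "y \<in> verts G" "e = {x, y}"
      by (rule simple_graph_edgeE[OF simple])
    with e have "f x \<noteq> f y" unfolding B_def by auto
    moreover have "x \<in> verts (H (f x))" "y \<in> verts (H (f y))"
      using xy by (auto simp: H_def)
    ultimately show "\<exists>i\<in>{1..t}. \<exists>j\<in>{1..t}. i \<noteq> j \<and>
        (\<exists>x\<in>verts (H i). \<exists>y\<in>verts (H j). e = {x, y})"
      using f xy by blast
  qed
  have "verts G = (\<Union>i\<in>{1..t}. verts (H i))"
    using f by (auto simp: H_def)
  moreover have "edges G = (\<Union>i\<in>{1..t}. edges (H i)) \<union> (\<lambda>i. {v, w i}) ` ({1..t} - {f v}) \<union> B"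
  proof -
    have "e \<in> (\<Union>i\<in>{1..t}. edges (H i)) \<union> B" if e: "e \<in> edges G" for e
    proof -
      obtain x y where xy: "x \<in> verts G" "y \<in> verts G" "e = {x, y}"
        by (rule simple_graph_edgeE[OF simple e])
      show ?thesis
      proof (cases "f x = f y")
        case True
        with e xy have "e \<in> edges (H (f x))" by (simp add: H_def)
        with f xy(1) show ?thesis by blast
      next
        case False
        with e xy show ?thesis by (auto simp: B_def)
      qed
    qed
    moreover have "edges (H i) \<subseteq> edges G" for i
      by (auto simp: H_def)
    moreover have "B \<subseteq> edges G"
      by (auto simp: B_def)
    ultimately show ?thesis
      using w by blast
  qed
  ultimately have G: "G = \<lparr>verts = (\<Union>i\<in>{1..t}. verts (H i)),
      edges = (\<Union>i\<in>{1..t}. edges (H i)) \<union> (\<lambda>i. {v, w i}) ` ({1..t} - {f v}) \<union> B\<rparr>"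
    by (simp add: graph.equality)
  have match: "matching (edges_between G (verts (H i)) (verts (H j)))" if "i \<noteq> j" for i j
    unfolding matching_def
  proof (rule pairwiseI)
    fix e e' assume "e \<in> edges_between G (verts (H i)) (verts (H j))"
      "e' \<in> edges_between G (verts (H i)) (verts (H j))" "e \<noteq> e'"
    then obtain a b a' b' where e: "{a, b} \<in> edges G" "e = {a, b}" "f a = i" "f b = j"
      and e': "{a', b'} \<in> edges G" "e' = {a', b'}" "f a' = i" "f b' = j"
      unfolding edges_between_def H_def by auto
    \<comment> \<open>If the edges shared \<open>a\<close>, their other ends \<open>b\<close> and
      \<open>b'\<close> would be neighbors of \<open>a\<close> of the same color \<open>j\<close>,
      hence equal. The case of a shared \<open>b\<close> is symmetric, and \<open>a = b'\<close> or
      \<open>b = a'\<close> is excluded by color since \<open>i\<close> and \<open>j\<close>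
      differ.\<close>
    have "a \<noteq> a'"
      using inj[of a b b'] e e' \<open>e \<noteq> e'\<close> by auto
    moreover have "b \<noteq> b'"
      using inj[of b a a'] e e' \<open>e \<noteq> e'\<close> by (auto simp: insert_commute)
    ultimately show "disjnt e e'"
      using e e' that by (auto simp: disjnt_def)
  qed
  have "1 \<le> t" using k by simp
  moreover have "edges (H (f v)) \<noteq> {}" using edge_v by blast
  moreover have "\<forall>i\<in>{1..t}. simple_graph (H i) \<and> verts (H i) \<noteq> {} \<and> max_degree (H i) \<le> 1"
    by (intro ballI conjI simpleH nonemptyH maxH)
  moreover have "\<forall>i\<in>{1..t}. \<forall>j\<in>{1..t}. i \<noteq> j \<longrightarrow>
      matching (edges_between G (verts (H i)) (verts (H j)))"
    by (intro ballI impI match)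
  ultimately show ?thesis
    unfolding Theta_def mem_Collect_eq using disj k v' wH BH G
    by - (rule exI[of _ t], rule exI[of _ H], rule exI[of _ "f v"], rule exI[of _ v],
      rule exI[of _ w], rule exI[of _ B], intro conjI; assumption)
qed

text \<open>The lower bound \<open>max_degree G\<close> holds for every nonempty simple graph, so
  only the opposite inequality has to be matched with membership in \<open>Theta\<close>. If
  equality holds, an optimal coloring uses \<open>max_degree G\<close> colors.\<close>

theorem theorem3:
  fixes G :: "'a graph"
  assumes "simple_graph G" and "verts G \<noteq> {}"
  shows "injective_chromatic_number G = max_degree G \<longleftrightarrow> G \<in> Theta"
proof -
  obtain f where f: "injective_coloring G (injective_chromatic_number G) f"
    using injective_chromatic_number_attained[OF assms(1)] .
  then have "max_degree G \<le> injective_chromatic_number G"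
    by (rule max_degree_le_colors[OF assms])
  then show ?thesis
    using f max_degree_coloring_imp_Theta[OF assms, of f]
      Theta_imp_chromatic_number_le_max_degree[OF assms(1)] by auto
qed

end
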